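(* Let $A$ and $D$ be real symmetric and semi-positive definite $N\times N$ matrices with constant elements, let $p\geqslant 1$ and let $C_p$ be the $(N-p)\times N$ matrix of synchronization by $p$-groups defined in the context. If the system $$U''+\mathcal LU+AU+D\mathcal GU'=0$$ is uniformly synchronizable by $p$-groups, then necessarily $$\operatorname{rank}(C_pD)\geqslant N-p.$$
   Context: $H$ and $V$ are infinite-dimensional real Hilbert spaces with $V\subset H\subset V'$, where $V'$ is the dual of $V$, $H$ is identified with its dual, and the embeddings are dense and compact. $L:V\to V'$ is the duality mapping, $\langle Lu,\phi\rangle_{V',V}=(u,\phi)_V$. $g:V\to V'$ is a linear continuous symmetric operator with $\langle gv,v\rangle_{V',V}\geqslant 0$ for all $v\in V$. With $I$ the identity of $\mathbb R^N$, $\mathcal L=LI$ and $\mathcal G=gI$ act componentwise on $V^N$; matrices act on the $\mathbb R^N$-index. The solution with initial data $(U_0,U_1)\in(V\times H)^N$ is the weak (mild) solution $U\in C^0(\mathbb R^+,V^N)\cap C^1(\mathbb R^+,H^N)$ given by the $C_0$-semigroup on $(V\times H)^N$ whose generator is $(U,Z)\mapsto (Z,-\mathcal LU-AU-D\mathcal GZ)$ with domain $\{(U,Z)\in V^N\times V^N:\ \mathcal LU+AU+D\mathcal GZ\in H^N\}$. Groups: integers $0=n_0<n_1<\dots<n_p=N$ with $n_r-n_{r-1}\geqslant 2$ for $1\leqslant r\leqslant p$ are fixed. $S_r$ is the $(n_r-n_{r-1}-1)\times(n_r-n_{r-1})$ matrix whose $i$-th row has $1$ in column $i$, $-1$ in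 column $i+1$, and $0$ elsewhere; $C_p=\operatorname{diag}(S_1,\dots,S_p)$ (block diagonal), of order $(N-p)\times N$. Uniform synchronizability by $p$-groups: there exist constants $M\geqslant 1$, $\omega>0$ such that for every $(U_0,U_1)\in(V\times H)^N$ the corresponding solution satisfies $$\|C_p(U(t),U'(t))\|_{(V\times H)^{N-p}}\leqslant Me^{-\omega t}\|C_p(U_0,U_1)\|_{(V\times H)^{N-p}},\quad t\geqslant 0,$$ where $C_p(U,U')=(C_pU,C_pU')$. *)

theory Defs
  imports "HOL-Analysis.Analysis"
begin

definition C0_semigroup :: "(real \<Rightarrow> 'x::banach \<Rightarrow>\<^sub>L 'x) \<Rightarrow> bool" where
  "C0_semigroup S \<longleftrightarrow>
     S 0 = id_blinfun \<and>
     (\<forall>s\<ge>0. \<forall>t\<ge>0. S (s + t) = S s o\<^sub>L S t) \<and>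
     (\<forall>x. continuous_on {0..} (\<lambda>t. S t x))"

text \<open>An unbounded operator is represented by its graph, so that an equation between
  operators includes the equality of their domains.\<close>

definition generator :: "(real \<Rightarrow> 'x::banach \<Rightarrow>\<^sub>L 'x) \<Rightarrow> ('x \<times> 'x) set" where
  "generator S = {(x, y). ((\<lambda>h. (S h x - x) /\<^sub>R h) \<longlongrightarrow> y) (at_right 0)}"

definition infinite_dimensional :: "'a::real_vector itself \<Rightarrow> bool" where
  "infinite_dimensional _ \<longleftrightarrow> (\<nexists>B :: 'a set. finite B \<and> span B = UNIV)"

definition dense_compact_embedding ::
  "('a::real_normed_vector \<Rightarrow>\<^sub>L 'b::real_normed_vector) \<Rightarrow> bool" where
  "dense_compact_embedding f \<longleftrightarrow>
     inj f \<and> closure (range f) = UNIV \<and> (\<forall>B. bounded B \<longrightarrow> compact (closure (f ` B)))"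

text \<open>V and H are types and the inclusion of V in H is an explicit embedding \<open>\<iota>\<close>; the dual V'
  is the type of bounded linear functionals on V. With H identified with its dual, the inclusion
  of H in V' sends \<open>h\<close> to \<open>v \<mapsto> (h, \<iota> v)\<^sub>H\<close>.\<close>

definition H_into_dual ::
  "('v::real_inner \<Rightarrow>\<^sub>L 'h::real_inner) \<Rightarrow> 'h \<Rightarrow>\<^sub>L ('v \<Rightarrow>\<^sub>L real)" where
  "H_into_dual \<iota> = Blinfun (\<lambda>h. blinfun_inner_right h o\<^sub>L \<iota>)"

lemma H_into_dual_apply: "H_into_dual \<iota> h v = h \<bullet> \<iota> v"
proof -
  have "bounded_linear (\<lambda>h. blinfun_inner_right h o\<^sub>L \<iota>)"
    by (intro bounded_linear_intros)
  then show ?thesis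
    by (simp add: H_into_dual_def bounded_linear_Blinfun_apply)
qed

definition gelfand_triple ::
  "('v::{real_inner,banach} \<Rightarrow>\<^sub>L 'h::{real_inner,banach}) \<Rightarrow> bool" where
  "gelfand_triple \<iota> \<longleftrightarrow>
     infinite_dimensional TYPE('v) \<and> infinite_dimensional TYPE('h) \<and>
     dense_compact_embedding \<iota> \<and> dense_compact_embedding (H_into_dual \<iota>)"

definition duality_map :: "'v::real_inner \<Rightarrow> 'v \<Rightarrow>\<^sub>L real" where
  "duality_map u = blinfun_inner_right u"

definition componentwise :: "('a \<Rightarrow> 'b) \<Rightarrow> 'a^'n \<Rightarrow> 'b^'n" where
  "componentwise f U = (\<chi> i. f (U $ i))"

definition mat_act :: "real^'n^'m \<Rightarrow> 'a::real_vector^'n \<Rightarrow> 'a^'m" where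
  "mat_act M U = (\<chi> i. \<Sum>j\<in>UNIV. M $ i $ j *\<^sub>R U $ j)"

text \<open>The state space is \<open>V\<^sup>N \<times> H\<^sup>N\<close>, whose norm is that of \<open>(V \<times> H)\<^sup>N\<close>. Below
  \<open>Z\<close> is in \<open>V\<^sup>N\<close>, hence occurs embedded as the second component of the state, and
  \<open>F\<close> in \<open>H\<^sup>N\<close> is the value of \<open>LU + AU + DgZ\<close>, an equation that is meaningful in \<open>V'\<^sup>N\<close>.\<close>

definition system_operator ::
  "('v::real_inner \<Rightarrow>\<^sub>L 'h::real_inner) \<Rightarrow> ('v \<Rightarrow>\<^sub>L ('v \<Rightarrow>\<^sub>L real)) \<Rightarrow>
   real^'n^'n \<Rightarrow> real^'n^'n \<Rightarrow> ((('v^'n) \<times> ('h^'n)) \<times> (('v^'n) \<times> ('h^'n))) set" where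
  "system_operator \<iota> g A D =
     {((U, componentwise \<iota> Z), (Z, - F)) | U Z F.
        componentwise duality_map U
        + mat_act A (componentwise (\<lambda>u. H_into_dual \<iota> (\<iota> u)) U)
        + mat_act D (componentwise g Z)
        = componentwise (H_into_dual \<iota>) F}"

definition solution ::
  "(real \<Rightarrow> (('v::{real_inner,banach}^'n) \<times> ('h::{real_inner,banach}^'n)) \<Rightarrow>\<^sub>L (('v^'n) \<times> ('h^'n))) \<Rightarrow>
   'v^'n \<Rightarrow> 'h^'n \<Rightarrow> real \<Rightarrow> 'v^'n" where
  "solution S U0 U1 t = fst (S t (U0, U1))"

text \<open>\<open>U'\<close> is the derivative of the solution as a function with values in \<open>H\<^sup>N\<close>, one-sided at 0.\<close>

definition velocity ::
  "('v::real_inner \<Rightarrow>\<^sub>L 'h::real_inner) \<Rightarrow> (real \<Rightarrow> 'v^'n) \<Rightarrow> real \<Rightarrow> 'h^'n" where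
  "velocity \<iota> U t = vector_derivative (\<lambda>s. componentwise \<iota> (U s)) (at t within {0..})"

definition group_partition :: "nat \<Rightarrow> (nat \<Rightarrow> nat) \<Rightarrow> nat \<Rightarrow> bool" where
  "group_partition p n N \<longleftrightarrow> n 0 = 0 \<and> n p = N \<and> (\<forall>r\<in>{1..p}. n (r - 1) + 2 \<le> n r)"

text \<open>The order of a finite index type numbers its elements \<open>0, 1, 2, \<dots>\<close>\<close>

definition pos :: "'n::{finite,linorder} \<Rightarrow> nat" where
  "pos i = card {..<i}"

text \<open>Entries of \<open>S\<^sub>r\<close>, numbered from 0; they do not depend on the size of the block.\<close>

definition sync_block :: "nat \<Rightarrow> nat \<Rightarrow> real" where
  "sync_block i j = (if j = i then 1 else if j = i + 1 then - 1 else 0)"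

text \<open>The blocks \<open>S\<^sub>1, \<dots>, S\<^sub>r\<close> have \<open>n r - r\<close> rows and \<open>n r\<close> columns altogether, so that
  (numbering from 0) \<open>S\<^sub>r\<close> occupies rows \<open>n (r - 1) - (r - 1)\<close> to \<open>n r - r - 1\<close> and columns
  \<open>n (r - 1)\<close> to \<open>n r - 1\<close>. The row type \<open>'m\<close> is to have \<open>N - p\<close> elements.\<close>

definition sync_matrix :: "nat \<Rightarrow> (nat \<Rightarrow> nat) \<Rightarrow> real^'n::{finite,linorder}^'m::{finite,linorder}" where
  "sync_matrix p n = (\<chi> i j. \<Sum>r=1..p.
     if pos i \<in> {n (r - 1) - (r - 1)..<n r - r} \<and> pos j \<in> {n (r - 1)..<n r}
     then sync_block (pos i - (n (r - 1) - (r - 1))) (pos j - n (r - 1))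
     else 0)"

definition uniformly_synchronizable ::
  "('v::{real_inner,banach} \<Rightarrow>\<^sub>L 'h::{real_inner,banach}) \<Rightarrow>
   (real \<Rightarrow> (('v^'n) \<times> ('h^'n)) \<Rightarrow>\<^sub>L (('v^'n) \<times> ('h^'n))) \<Rightarrow> real^'n^'m \<Rightarrow> bool" where
  "uniformly_synchronizable \<iota> S C \<longleftrightarrow>
     (\<exists>M\<ge>1. \<exists>\<omega>>0. \<forall>U0 U1. \<forall>t\<ge>0.
        norm (mat_act C (solution S U0 U1 t), mat_act C (velocity \<iota> (solution S U0 U1) t))
        \<le> M * exp (- \<omega> * t) * norm (mat_act C U0, mat_act C U1))"

end

theory Submission
  imports Defs
begin

text \<open>If the rank of \<open>C\<^sub>p D\<close> were smaller than \<open>N - p\<close>, there would be \<open>E = C\<^sub>p\<^sup>T a \<noteq> 0\<close> with \<open>DE = 0\<close>.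
  Synchronization makes \<open>Ker C\<^sub>p\<close> invariant under \<open>A\<close>, hence \<open>AE = C\<^sub>p\<^sup>T b\<close>, and \<open>u = E \<cdot> U\<close> solves
  \<open>u'' + Lu + b \<cdot> C\<^sub>pU = 0\<close>, which is conservative up to a compact perturbation, although the energy of
  \<open>u\<close> decays uniformly. On \<open>[0, T]\<close> the perturbation is made negligible by data \<open>U\<^sub>0 = E \<otimes> v\<close>,
  \<open>U\<^sub>1 = 0\<close>, with \<open>v = L\<^sup>-\<^sup>1h\<close> subject to finitely many orthogonality conditions (these replace the usual
  weakly null sequence). For \<open>T\<close> large, this contradicts the decay of the energy.\<close>

section \<open>Right derivatives and orbits of semigroups\<close>

text \<open>The times up to which the bound from \<open>a\<close> holds form a compact set. At its
  greatest element a further step would still be possible unless that element is \<open>b\<close>.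
  Only increments to the right are used, since \<open>generator\<close> is defined by a right
  limit.\<close>

lemma increment_bound_right:
  fixes f :: "real \<Rightarrow> 'a::real_normed_vector"
  assumes "a \<le> b" and cont: "continuous_on {a..b} f"
    and steps: "\<And>t. \<lbrakk>a \<le> t; t < b\<rbrakk> \<Longrightarrow> \<exists>d>0. \<forall>s. t < s \<and> s < t + d \<longrightarrow> norm (f s - f t) \<le> e * (s - t)"
  shows "norm (f b - f a) \<le> e * (b - a)"
proof -
  define A where "A = {t \<in> {a..b}. norm (f t - f a) \<le> e * (t - a)}"
  have "closed A"
    unfolding A_def by (intro continuous_on_closed_Collect_le continuous_intros cont)
  moreover have "bounded A"
    by (rule bounded_subset[of "{a..b}"]) (auto simp: A_def)
  ultimately have "compact A" by (simp add: compact_eq_bounded_closed)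
  moreover have "a \<in> A" using \<open>a \<le> b\<close> by (simp add: A_def)
  ultimately obtain c where c: "c \<in> A" and max: "\<And>t. t \<in> A \<Longrightarrow> t \<le> c"
    using compact_attains_sup[of A] by auto
  have "c = b"
  proof (rule ccontr)
    assume "c \<noteq> b"
    with c have ac: "a \<le> c" "c < b" by (auto simp: A_def)
    with steps obtain d where d: "d > 0"
      "\<And>s. \<lbrakk>c < s; s < c + d\<rbrakk> \<Longrightarrow> norm (f s - f c) \<le> e * (s - c)"
      by blast
    define s where "s = min b (c + d / 2)"
    have s: "c < s" "s < c + d" "s \<le> b" using d(1) ac by (auto simp: s_def)
    have "norm (f s - f a) \<le> norm (f s - f c) + norm (f c - f a)"
      using norm_triangle_ineq[of "f s - f c" "f c - f a"] by simp
    also have "\<dots> \<le> e * (s - c) + e * (c - a)"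
      using d(2)[OF s(1,2)] c by (auto simp: A_def)
    finally have "s \<in> A" using s ac by (simp add: A_def algebra_simps)
    with max s(1) show False by fastforce
  qed
  with c show ?thesis by (simp add: A_def)
qed

text \<open>Near \<open>t\<close> the right derivative \<open>f'\<close> differs little from
  \<open>f' t\<close>, so \<open>F s = f s - s *\<^sub>R f' t\<close> has small right increments.
  The increment bound on intervals on either side of \<open>t\<close> turns this into a two-sided
  estimate.\<close>

lemma right_derivative_imp_derivative:
  fixes f f' :: "real \<Rightarrow> 'a::real_normed_vector"
  assumes cont: "continuous_on {0..} f" and cont': "continuous_on {0..} f'"
    and right: "\<And>t. 0 \<le> t \<Longrightarrow> ((\<lambda>h. (f (t + h) - f t) /\<^sub>R h) \<longlongrightarrow> f' t) (at_right 0)"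
    and "0 \<le> t"
  shows "(f has_vector_derivative f' t) (at t within {0..})"
  unfolding has_vector_derivative_def has_derivative_within_alt
proof (intro conjI allI impI)
  show "bounded_linear (\<lambda>x. x *\<^sub>R f' t)" by (intro bounded_linear_intros)
  fix e :: real assume "e > 0"
  \<comment> \<open>One half of \<open>e\<close> pays for the variation of \<open>f'\<close>, the
    other half for the error of the difference quotient.\<close>
  then obtain d where "d > 0" and d: "\<And>s. \<lbrakk>0 \<le> s; dist s t < d\<rbrakk> \<Longrightarrow> dist (f' s) (f' t) < e / 2"
    using cont' \<open>0 \<le> t\<close> unfolding continuous_on_iff
    by (metis atLeast_iff half_gt_zero)
  define F where "F s = f s - s *\<^sub>R f' t" for s
  have bound: "norm (F b - F a) \<le> e * (b - a)"
    if ab: "0 \<le> a" "a \<le> b" "dist a t < d" "dist b t < d" for a b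
  proof (rule increment_bound_right[OF ab(2)])
    show "continuous_on {a..b} F"
      unfolding F_def using ab
      by (intro continuous_intros continuous_on_subset[OF cont]) auto
    fix s assume s: "a \<le> s" "s < b"
    then have "0 \<le> s" "dist s t < d" using ab by (auto simp: dist_real_def)
    note near = d[OF this]
    have "\<forall>\<^sub>F h in at_right 0. dist ((f (s + h) - f s) /\<^sub>R h) (f' s) < e / 2"
      using right[OF \<open>0 \<le> s\<close>] \<open>e > 0\<close> unfolding tendsto_iff by (metis half_gt_zero)
    then obtain r where "r > 0"
      and r: "\<And>h. \<lbrakk>0 < h; h < r\<rbrakk> \<Longrightarrow> dist ((f (s + h) - f s) /\<^sub>R h) (f' s) < e / 2"
      unfolding eventually_at_right_field by auto
    have "norm (F q - F s) \<le> e * (q - s)" if q: "s < q" "q < s + r" for q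
    proof -
      have "(q - s) *\<^sub>R ((f q - f s) /\<^sub>R (q - s)) = f q - f s" using q by simp
      moreover have "F q - F s = f q - f s - (q - s) *\<^sub>R f' t" by (simp add: F_def scaleR_left_diff_distrib)
      ultimately have eq: "F q - F s = (q - s) *\<^sub>R ((f q - f s) /\<^sub>R (q - s) - f' t)"
        by (simp only: scaleR_right_diff_distrib)
      have "norm ((f q - f s) /\<^sub>R (q - s) - f' t) \<le> e"
        using near r[of "q - s"] q
          norm_triangle_ineq[of "(f q - f s) /\<^sub>R (q - s) - f' s" "f' s - f' t"]
        by (simp add: dist_norm)
      then show ?thesis unfolding eq using q mult_left_mono[of _ e "q - s"]
        by (simp add: mult.commute)
    qed
    with \<open>r > 0\<close> show "\<exists>d>0. \<forall>q. s < q \<and> q < s + d \<longrightarrow> norm (F q - F s) \<le> e * (q - s)"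
      by blast
  qed
  have "norm (f y - f t - (y - t) *\<^sub>R f' t) \<le> e * norm (y - t)"
    if y: "y \<in> {0..}" "norm (y - t) < d" for y
  proof (cases "t \<le> y")
    case True
    then show ?thesis using bound[of t y] y \<open>0 \<le> t\<close> \<open>d > 0\<close>
      by (simp add: F_def dist_norm algebra_simps)
  next
    case False
    then have "norm (F t - F y) \<le> e * (t - y)" using bound[of y t] y \<open>0 \<le> t\<close> \<open>d > 0\<close>
      by (simp add: dist_norm)
    with False show ?thesis
      by (simp add: norm_minus_commute[of "F t"]) (simp add: F_def algebra_simps)
  qed
  with \<open>d > 0\<close> show "\<exists>d>0. \<forall>y\<in>{0..}. norm (y - t) < d \<longrightarrow>
      norm (f y - f t - (y - t) *\<^sub>R f' t) \<le> e * norm (y - t)"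
    by blast
qed

text \<open>\<open>S t\<close> commutes with the difference quotients of the semigroup, so
  \<open>S t y\<close> is the right derivative of the orbit. It is continuous in \<open>t\<close>,
  hence a true derivative.\<close>

lemma generator_orbit:
  assumes S: "C0_semigroup S" and xy: "(x, y) \<in> generator S" and "0 \<le> t"
  shows "(S t x, S t y) \<in> generator S"
    and "((\<lambda>t. S t x) has_vector_derivative S t y) (at t within {0..})"
proof -
  have add: "S (s + r) z = S s (S r z)" if "0 \<le> s" "0 \<le> r" for s r z
    using S that by (simp add: C0_semigroup_def)
  have cont: "continuous_on {0..} (\<lambda>t. S t z)" for z
    using S by (simp add: C0_semigroup_def)
  have lim: "((\<lambda>h. S s ((S h x - x) /\<^sub>R h)) \<longlongrightarrow> S s y) (at_right 0)" for s
    using xy by (intro tendsto_intros) (simp add: generator_def)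
  have right: "((\<lambda>h. (S (s + h) x - S s x) /\<^sub>R h) \<longlongrightarrow> S s y) (at_right 0)" if "0 \<le> s" for s
    using lim[of s] by (rule Lim_transform_eventually)
      (use that in \<open>auto simp: eventually_at_right_field add blinfun.bilinear_simps intro!: exI[of _ 1]\<close>)
  show "((\<lambda>t. S t x) has_vector_derivative S t y) (at t within {0..})"
    using right_derivative_imp_derivative[OF cont cont right \<open>0 \<le> t\<close>] .
  have "((\<lambda>h. (S h (S t x) - S t x) /\<^sub>R h) \<longlongrightarrow> S t y) (at_right 0)"
    using right[OF \<open>0 \<le> t\<close>] by (rule Lim_transform_eventually)
      (use \<open>0 \<le> t\<close> in \<open>auto simp: eventually_at_right_field add add.commute[of t] intro!: exI[of _ 1]\<close>)
  then show "(S t x, S t y) \<in> generator S" by (simp add: generator_def)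
qed

section \<open>Linear functionals, Riesz representation and compact maps\<close>

text \<open>Finitely many conditions cut out a subspace of finite codimension. The induction carries
  the stronger claim that the common kernel lies in no finitely generated span: one more functional
  \<open>\<phi>\<close> removes at most one direction \<open>d\<close>.\<close>

lemma infinite_dimensional_common_kernel:
  fixes \<Phi> :: "('a::real_vector \<Rightarrow> real) set"
  assumes inf: "infinite_dimensional TYPE('a)" and "finite \<Phi>" and "\<And>\<phi>. \<phi> \<in> \<Phi> \<Longrightarrow> linear \<phi>"
  obtains x where "x \<noteq> 0" "\<And>\<phi>. \<phi> \<in> \<Phi> \<Longrightarrow> \<phi> x = 0"
proof -
  have "\<not> {x. \<forall>\<phi>\<in>\<Phi>. \<phi> x = 0} \<subseteq> span B" if "finite B" for B
    using assms(2,3) that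
  proof (induction \<Phi> arbitrary: B rule: finite_induct)
    case empty
    then show ?case using inf by (auto simp: infinite_dimensional_def)
  next
    case (insert \<phi> \<Phi>)
    have lin: "linear \<psi>" if "\<psi> \<in> insert \<phi> \<Phi>" for \<psi> using insert.prems that by blast
    let ?K = "{x. \<forall>\<psi>\<in>\<Phi>. \<psi> x = 0}"
    show ?case
    proof
      assume sub: "{x. \<forall>\<psi>\<in>insert \<phi> \<Phi>. \<psi> x = 0} \<subseteq> span B"
      have notsub: "\<not> ?K \<subseteq> span B'" if "finite B'" for B'
        using insert.IH[OF lin that] by blast
      then obtain d where d: "d \<in> ?K" "\<phi> d \<noteq> 0" using sub insert.prems(2) by blast
      have "?K \<subseteq> span (insert d B)"
      proof
        fix x assume x: "x \<in> ?K"
        have "x - (\<phi> x / \<phi> d) *\<^sub>R d \<in> span B"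
          using x d by (intro subsetD[OF sub]) (auto simp: lin linear_diff linear_cmul)
        then show "x \<in> span (insert d B)" by (auto simp: span_breakdown_eq)
      qed
      with notsub insert.prems(2) show False by blast
    qed
  qed
  from this[of "{}"] show ?thesis using that by auto
qed

text \<open>The representing vector minimizes the quadratic functional \<open>J\<close>. The
  parallelogram law makes a minimizing sequence Cauchy, and the vanishing first variation at the
  minimum is the claimed identity.\<close>

lemma riesz_representation:
  fixes f :: "'v::{real_inner,banach} \<Rightarrow>\<^sub>L real"
  obtains v where "\<And>w. v \<bullet> w = f w"
proof -
  define J where "J x = x \<bullet> x - 2 * f x" for x
  have expand: "J (x + t *\<^sub>R w) = J x + t\<^sup>2 * (w \<bullet> w) + 2 * t * (x \<bullet> w - f w)" for x w t
    by (simp add: J_def blinfun.bilinear_simps inner_simps inner_commute power2_eq_square algebra_simps)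
  have lower: "- (norm f)\<^sup>2 \<le> J x" for x
  proof -
    have "2 * f x \<le> 2 * (norm f * norm x)" using norm_blinfun[of f x] by simp
    also have "\<dots> \<le> (norm f)\<^sup>2 + (norm x)\<^sup>2" using sum_squares_bound[of "norm f" "norm x"] by simp
    finally show ?thesis by (simp add: J_def power2_norm_eq_inner)
  qed
  then have bdd: "bdd_below (range J)" by (intro bdd_belowI) auto
  define m where "m = Inf (range J)"
  have m: "m \<le> J x" for x unfolding m_def by (rule cInf_lower[OF _ bdd]) simp
  have "\<exists>x. J x < m + inverse (Suc k)" for k
    using cInf_lessD[of "range J" "m + inverse (Suc k)"] unfolding m_def[symmetric] by auto
  then obtain x where x: "\<And>k. J (x k) < m + inverse (Suc k)" by metis
  have para: "(norm (a - b))\<^sup>2 \<le> 2 * (J a - m) + 2 * (J b - m)" for a b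
  proof -
    have "(norm (a - b))\<^sup>2 = 2 * J a + 2 * J b - 4 * J ((1/2) *\<^sub>R (a + b))"
      by (simp add: J_def power2_norm_eq_inner blinfun.bilinear_simps inner_simps inner_commute algebra_simps)
    with m[of "(1/2) *\<^sub>R (a + b)"] show ?thesis by simp
  qed
  have "Cauchy x"
  proof (rule metric_CauchyI)
    fix e :: real assume "e > 0"
    then obtain K where K: "inverse (Suc K) < e\<^sup>2 / 4"
      using reals_Archimedean[of "e\<^sup>2 / 4"] by auto
    have small: "J (x k) - m < e\<^sup>2 / 4" if "k \<ge> K" for k
    proof -
      have "inverse (real (Suc k)) \<le> inverse (real (Suc K))" using that by (intro le_imp_inverse_le) auto
      with x[of k] K show ?thesis by linarith
    qed
    have "dist (x k) (x l) < e" if "k \<ge> K" "l \<ge> K" for k l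
    proof -
      have "(norm (x k - x l))\<^sup>2 < e\<^sup>2" using para[of "x k" "x l"] small[OF that(1)] small[OF that(2)] by simp
      then show ?thesis using \<open>e > 0\<close> by (simp add: dist_norm power_less_imp_less_base)
    qed
    then show "\<exists>M. \<forall>k\<ge>M. \<forall>l\<ge>M. dist (x k) (x l) < e" by blast
  qed
  then obtain v where v: "x \<longlonglongrightarrow> v" by (auto simp: Cauchy_convergent_iff convergent_def)
  have "(\<lambda>k. J (x k)) \<longlonglongrightarrow> J v" unfolding J_def by (intro tendsto_intros v)
  moreover have "(\<lambda>k. m + inverse (Suc k)) \<longlonglongrightarrow> m + 0"
    by (intro tendsto_intros LIMSEQ_inverse_real_of_nat)
  ultimately have "J v \<le> m + 0" by (rule LIMSEQ_le) (use x in \<open>blast intro: less_imp_le\<close>)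
  have "v \<bullet> w = f w" for w
  proof (cases "w = 0")
    case False
    define r where "r = (v \<bullet> w - f w)"
    have ww: "w \<bullet> w > 0" using False by simp
    \<comment> \<open>The coefficient \<open>- r / (w \<bullet> w)\<close> minimizes
      \<open>J\<close> along the line through \<open>v\<close> in direction
      \<open>w\<close>.\<close>
    have "0 \<le> J (v + (- r / (w \<bullet> w)) *\<^sub>R w) - J v" using m[of "v + (- r / (w \<bullet> w)) *\<^sub>R w"] \<open>J v \<le> m + 0\<close> by simp
    also have "\<dots> = - r\<^sup>2 / (w \<bullet> w)"
      unfolding expand using ww by (simp add: r_def[symmetric] field_simps power2_eq_square)
    finally have "r\<^sup>2 \<le> 0" using ww by (simp add: field_simps)
    then show ?thesis by (simp add: r_def)
  qed (simp add: blinfun.bilinear_simps)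
  with that show ?thesis by blast
qed

text \<open>\<open>Y\<close> is a finite \<open>\<epsilon>\<close>-net of the image of the unit
  ball. If a point \<open>k\<close> of the image is orthogonal to a net point \<open>y\<close> near
  it, then |k|^2 = k \<bullet> (k - y) \<le> \<epsilon> |k|.\<close>

lemma compact_map_small_on_kernel:
  fixes \<iota> :: "'v::real_normed_vector \<Rightarrow>\<^sub>L 'h::{real_inner,complete_space}"
  assumes compact: "\<And>B. bounded B \<Longrightarrow> compact (closure (\<iota> ` B))"
    and T: "bounded_linear (T :: 'u::real_normed_vector \<Rightarrow> 'v)" and "\<epsilon> > 0"
  obtains Y where "finite Y"
    "\<And>v. (\<And>y. y \<in> Y \<Longrightarrow> \<iota> (T v) \<bullet> y = 0) \<Longrightarrow> norm (\<iota> (T v)) \<le> \<epsilon> * norm v"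
proof -
  let ?K = "closure (\<iota> ` T ` cball 0 1)"
  interpret T: bounded_linear T by (rule T)
  have "compact ?K" by (intro compact bounded_linear_image[OF _ T]) simp
  then obtain Y where Y: "finite Y" "?K \<subseteq> (\<Union>y\<in>Y. ball y \<epsilon>)"
    unfolding compact_eq_totally_bounded using \<open>\<epsilon> > 0\<close> by auto
  have "norm (\<iota> (T v)) \<le> \<epsilon> * norm v" if orth: "\<And>y. y \<in> Y \<Longrightarrow> \<iota> (T v) \<bullet> y = 0" for v
  proof (cases "v = 0")
    case False
    define k where "k = \<iota> (T (v /\<^sub>R norm v))"
    have "k \<in> ?K" unfolding k_def using False by (intro subsetD[OF closure_subset]) auto
    then obtain y where y: "y \<in> Y" "norm (k - y) < \<epsilon>"
      using Y(2) by (auto simp: dist_norm norm_minus_commute)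
    have "k \<bullet> y = 0" unfolding k_def by (simp add: T.scaleR blinfun.scaleR_right orth[OF y(1)])
    then have "norm k * norm k = k \<bullet> (k - y)"
      by (simp add: inner_diff_right norm_eq_sqrt_inner)
    also have "\<dots> \<le> norm k * norm (k - y)" by (rule norm_cauchy_schwarz)
    finally have "norm k \<le> norm (k - y)" by (metis mult_le_cancel_left_pos norm_ge_zero order_le_less)
    with y have "norm k \<le> \<epsilon>" by simp
    then show ?thesis using False
      by (simp add: k_def T.scaleR blinfun.scaleR_right field_simps)
  qed (simp add: T.zero blinfun.zero_right)
  with Y(1) that show ?thesis by blast
qed

section \<open>Full row rank of the synchronization matrix\<close>

lemma pos_strict_mono: "i < j \<Longrightarrow> pos i < pos (j :: 'n::{finite,linorder})"
  unfolding pos_def by (rule psubset_card_mono) (auto simp: psubset_eq set_eq_iff not_less intro: less_trans)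

lemma pos_less_card: "pos (i :: 'n::{finite,linorder}) < CARD('n)"
  unfolding pos_def by (rule psubset_card_mono) auto

lemma ex_pos_eq:
  assumes "k < CARD('n::{finite,linorder})"
  obtains i :: "'n::{finite,linorder}" where "pos i = k"
proof -
  have "inj (pos :: 'n \<Rightarrow> nat)"
    by (rule linorder_injI) (metis pos_strict_mono less_irrefl)
  then have "card (range (pos :: 'n \<Rightarrow> nat)) = card {..<CARD('n)}" by (simp add: card_image)
  then have "range (pos :: 'n \<Rightarrow> nat) = {..<CARD('n)}"
    by (intro card_subset_eq) (auto simp: pos_less_card)
  with assms that show ?thesis by (metis imageE lessThan_iff)
qed

lemma group_partition_gap:
  assumes "group_partition p n N" "r \<le> s" "s \<le> p"
  shows "n r + 2 * (s - r) \<le> n s"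
  using assms(2,3)
proof (induction s rule: dec_induct)
  case (step s)
  have "n s + 2 \<le> n (Suc s)" using assms(1) step.prems by (auto simp: group_partition_def dest: bspec[of _ _ "Suc s"])
  with step show ?case by simp
qed simp

lemma group_partition_rows_mono:
  assumes "group_partition p n N" "r \<le> s" "s \<le> p"
  shows "n r - r \<le> n s - s"
  using group_partition_gap[OF assms] assms(2) by linarith

text \<open>In its row \<open>i\<close>, which lies in block \<open>r\<close>, the matrix has its leading entry in column
  \<open>pos i + r - 1\<close>; these columns increase with \<open>i\<close>, so the matrix is in echelon form.\<close>

lemma sync_matrix_leading_entry:
  fixes i :: "'m::{finite,linorder}" and j :: "'n::{finite,linorder}"
  assumes part: "group_partition p n N" and r: "1 \<le> r" "r \<le> p"
    and i: "n (r - 1) - (r - 1) \<le> pos i" "pos i < n r - r"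
    and j: "pos j \<le> pos i + (r - 1)"
  shows "(sync_matrix p n :: real^'n::{finite,linorder}^'m::{finite,linorder}) $ i $ j = (if pos j = pos i + (r - 1) then 1 else 0)"
proof -
  let ?term = "\<lambda>s. if pos i \<in> {n (s - 1) - (s - 1)..<n s - s} \<and> pos j \<in> {n (s - 1)..<n s}
     then sync_block (pos i - (n (s - 1) - (s - 1))) (pos j - n (s - 1)) else 0"
  \<comment> \<open>The row ranges of different blocks are disjoint, so only block \<open>r\<close>
    contributes to row \<open>i\<close>.\<close>
  have "?term s = 0" if s: "s \<in> {1..p} - {r}" for s
  proof (cases "s < r")
    case True
    then have "n s - s \<le> n (r - 1) - (r - 1)"
      using group_partition_rows_mono[OF part, of s "r - 1"] r by simp
    with i show ?thesis by auto
  next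
    case False
    then have "n r - r \<le> n (s - 1) - (s - 1)"
      using group_partition_rows_mono[OF part, of r "s - 1"] s by auto
    with i show ?thesis by auto
  qed
  then have zero: "(\<Sum>s\<in>{1..p} - {r}. ?term s) = 0" by (intro sum.neutral) blast
  have "(sync_matrix p n :: real^'n::{finite,linorder}^'m::{finite,linorder}) $ i $ j = (\<Sum>s=1..p. ?term s)"
    unfolding sync_matrix_def by simp
  also have "\<dots> = ?term r + (\<Sum>s\<in>{1..p} - {r}. ?term s)" using r by (intro sum.remove) auto
  finally have "(sync_matrix p n :: real^'n::{finite,linorder}^'m::{finite,linorder}) $ i $ j = ?term r"
    unfolding zero by simp
  moreover have "?term r = (if pos j = pos i + (r - 1) then 1 else 0)"
  proof -
    have "n 0 = 0" using part by (simp add: group_partition_def)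
    \<comment> \<open>The first inequality makes the natural-number subtraction
      \<open>n (r - 1) - (r - 1)\<close> exact, so row and column offsets within the block can be
      compared.\<close>
    then have n: "2 * (r - 1) \<le> n (r - 1)" "n (r - 1) + 2 \<le> n r"
      using group_partition_gap[OF part, of 0 "r - 1"] group_partition_gap[OF part, of "r - 1" r] r by auto
    define q where "q = pos i - (n (r - 1) - (r - 1))"
    have "pos i = n (r - 1) - (r - 1) + q" using i(1) by (simp add: q_def)
    then have q: "pos i + (r - 1) = n (r - 1) + q" using n(1) by simp
    moreover have "pos i + r < n r" using i(2) by simp
    ultimately have "n (r - 1) + q < n r" using r(1) by linarith
    note q = q this
    from i have "?term r = (if pos j \<in> {n (r - 1)..<n r} then sync_block q (pos j - n (r - 1)) else 0)"
      by (simp add: q_def)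
    also have "\<dots> = (if pos j = n (r - 1) + q then 1 else 0)"
    proof (cases "pos j = n (r - 1) + q")
      case False
      have "pos j < n (r - 1) + q" using j q(1) False by linarith
      then have "sync_block q (pos j - n (r - 1)) = 0" if "n (r - 1) \<le> pos j"
        using that less_diff_conv2[OF that, of q] by (simp add: sync_block_def add.commute)
      with False show ?thesis by simp
    qed (use q(2) in \<open>simp add: sync_block_def\<close>)
    finally show ?thesis using q by simp
  qed
  ultimately show ?thesis by simp
qed

text \<open>The echelon form allows forward substitution. In the leading column of row
  \<open>i\<close>, earlier rows drop out by induction and later rows have entry 0, which leaves
  \<open>y $ i = 0\<close>.\<close>

lemma sync_matrix_transpose_kernel:
  fixes y :: "real^'m::{finite,linorder}"
  assumes part: "group_partition p n CARD('n::{finite,linorder})"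
    and card: "CARD('m::{finite,linorder}) = CARD('n::{finite,linorder}) - p"
    and ker: "transpose (sync_matrix p n :: real^'n::{finite,linorder}^'m::{finite,linorder}) *v y = 0"
  shows "y = 0"
proof -
  let ?C = "sync_matrix p n :: real^'n::{finite,linorder}^'m::{finite,linorder}"
  have n0: "n 0 = 0" and np: "n p = CARD('n)" using part by (auto simp: group_partition_def)
  have "\<exists>r. 1 \<le> r \<and> r \<le> p \<and> n (r - 1) - (r - 1) \<le> pos i \<and> pos i < n r - r" for i :: 'm
  proof -
    have ex: "pos i < n p - p" using pos_less_card[of i] by (simp add: np card)
    \<comment> \<open>The first \<open>r\<close> blocks contain \<open>n r - r\<close> rows, so the
      least such \<open>r\<close> is the block of row \<open>i\<close>; it is not 0 because
      \<open>n 0 = 0\<close>.\<close>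
    define r where "r = (LEAST r. pos i < n r - r)"
    have "pos i < n r - r" unfolding r_def using ex by (rule LeastI)
    moreover have "r \<le> p" unfolding r_def using ex by (rule Least_le)
    moreover have "r \<noteq> 0" using \<open>pos i < n r - r\<close> n0 by (intro notI) simp
    moreover from this have "\<not> pos i < n (r - 1) - (r - 1)"
      using not_less_Least[of "r - 1" "\<lambda>r. pos i < n r - r"] by (simp add: r_def[symmetric])
    ultimately show ?thesis by (intro exI[of _ r]) auto
  qed
  then obtain b where b: "\<And>i :: 'm. 1 \<le> b i" "\<And>i :: 'm. b i \<le> p"
    "\<And>i :: 'm. n (b i - 1) - (b i - 1) \<le> pos i" "\<And>i :: 'm. pos i < n (b i) - b i"
    by metis
  note entry = sync_matrix_leading_entry[OF part b]
  have b_mono: "b i \<le> b k" if "pos i \<le> pos k" for i k :: 'm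
  proof (rule ccontr)
    assume "\<not> b i \<le> b k"
    then have "n (b k) - b k \<le> n (b i - 1) - (b i - 1)"
      using group_partition_rows_mono[OF part, of "b k" "b i - 1"] b(1,2)[of i] by simp
    with b(3)[of i] b(4)[of k] that show False by simp
  qed
  have "y $ i = 0" for i
  proof (induction i rule: measure_induct_rule[of pos])
    case (less i)
    have "2 * p \<le> CARD('n)" using group_partition_gap[OF part, of 0 p] n0 np by simp
    have "n (b i) + 2 * (p - b i) \<le> CARD('n)"
      using group_partition_gap[OF part, of "b i" p] b(2)[of i] np by simp
    then have "pos i + (b i - 1) < CARD('n)" using b(1,2,4)[of i] by linarith
    then obtain j :: 'n where j: "pos j = pos i + (b i - 1)" by (rule ex_pos_eq)
    have "?C $ k $ j * y $ k = 0" if "k \<noteq> i" for k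
    proof (cases "pos k < pos i")
      case False
      then have "pos i < pos k" using that pos_strict_mono[of i k] pos_strict_mono[of k i] by (metis neqE)
      then have "pos j < pos k + (b k - 1)" using b_mono[of i k] j by simp
      then show ?thesis by (simp add: entry)
    qed (simp add: less)
    then have zero: "(\<Sum>k\<in>UNIV - {i}. ?C $ k $ j * y $ k) = 0" by (intro sum.neutral) blast
    have "(\<Sum>k\<in>UNIV. ?C $ k $ j * y $ k) = ?C $ i $ j * y $ i"
      by (subst sum.remove[of UNIV i]) (simp_all only: zero finite iso_tuple_UNIV_I add_0_right)
    moreover have "(\<Sum>k\<in>UNIV. ?C $ k $ j * y $ k) = 0"
      using arg_cong[OF ker, of "\<lambda>w. w $ j"] by (simp add: matrix_vector_mult_def transpose_def)
    ultimately show ?case using j by (simp add: entry)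
  qed
  then show ?thesis by (simp add: vec_eq_iff)
qed

section \<open>Pairings and elementary tensors for vector-valued tuples\<close>

text \<open>This is the pairing \<open>E \<cdot> U\<close>, for tuples with values in V, H or V'. It
  commutes with componentwise linear operators and moves a matrix, transposed, onto the
  coefficients.\<close>

definition vec_comb :: "real^'n \<Rightarrow> 'a::real_vector^'n \<Rightarrow> 'a" where
  "vec_comb a U = (\<Sum>i\<in>UNIV. a $ i *\<^sub>R U $ i)"

definition tensor :: "real^'n \<Rightarrow> 'a::real_vector \<Rightarrow> 'a^'n" where
  "tensor a v = (\<chi> i. a $ i *\<^sub>R v)"

lemma vec_comb_add: "vec_comb a (U + W) = vec_comb a U + vec_comb a W"
  by (simp add: vec_comb_def scaleR_add_right sum.distrib)

lemma vec_comb_minus: "vec_comb a (- U) = - vec_comb a U"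
  by (simp add: vec_comb_def sum_negf)

lemma norm_vec_comb: "norm (vec_comb a U) \<le> norm a * norm (U :: 'a::real_normed_vector^'n)"
proof -
  have "norm (vec_comb a U) \<le> (\<Sum>i\<in>UNIV. \<bar>a $ i\<bar> * \<bar>norm (U $ i)\<bar>)"
    unfolding vec_comb_def by (rule sum_norm_le) simp
  also have "\<dots> \<le> norm a * norm U"
    unfolding norm_vec_def using L2_set_mult_ineq[of "\<lambda>i. a $ i" "\<lambda>i. norm (U $ i)" UNIV] by (simp add: L2_set_def)
  finally show ?thesis .
qed

lemma bounded_linear_vec_comb: "bounded_linear (vec_comb a :: 'a::real_normed_vector^'n \<Rightarrow> 'a)"
proof (rule bounded_linear_intro)
  show "norm (vec_comb a U) \<le> norm U * norm a" for U :: "'a^'n"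
    using norm_vec_comb[of a U] by (simp add: mult.commute)
  show "vec_comb a (r *\<^sub>R U) = r *\<^sub>R vec_comb a U" for r and U :: "'a^'n"
    by (simp add: vec_comb_def scaleR_sum_right mult.commute)
qed (rule vec_comb_add)

lemma norm_tensor: "norm (tensor a v) = norm a * norm v"
  by (simp add: norm_vec_def tensor_def L2_set_def power_mult_distrib real_sqrt_mult flip: sum_distrib_right)

lemma bounded_linear_tensor: "bounded_linear (tensor a :: 'a::real_normed_vector \<Rightarrow> 'a^'n)"
proof (rule bounded_linear_intro)
  show "norm (tensor a v) \<le> norm v * norm a" for v :: 'a by (simp add: norm_tensor)
qed (simp_all add: tensor_def vec_eq_iff scaleR_add_right)

lemma vec_comb_tensor: "vec_comb a (tensor e v) = (a \<bullet> e) *\<^sub>R v"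
  by (simp add: vec_comb_def tensor_def inner_vec_def scaleR_sum_left)

lemma vec_comb_mat_act: "vec_comb a (mat_act M U) = vec_comb (transpose M *v a) U"
  unfolding vec_comb_def mat_act_def matrix_vector_mult_def transpose_def
  by (simp add: scaleR_sum_right scaleR_sum_left mult.commute) (rule sum.swap)

lemma vec_comb_componentwise: "linear f \<Longrightarrow> vec_comb a (componentwise f U) = f (vec_comb a U)"
  by (simp add: vec_comb_def componentwise_def linear_sum linear_cmul)

lemma mat_act_tensor: "mat_act M (tensor e v) = tensor (M *v e) v"
  by (simp add: mat_act_def tensor_def matrix_vector_mult_def vec_eq_iff scaleR_sum_left)

lemma componentwise_tensor: "linear f \<Longrightarrow> componentwise f (tensor e v) = tensor e (f v)"
  by (simp add: componentwise_def tensor_def vec_eq_iff linear_cmul)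

lemma mat_act_0: "mat_act M 0 = 0"
  by (simp add: mat_act_def vec_eq_iff)

lemma bounded_linear_componentwise:
  assumes "bounded_linear f"
  shows "bounded_linear (componentwise f :: 'a::real_normed_vector^'n \<Rightarrow> 'b::real_normed_vector^'n)"
proof -
  interpret bounded_linear f by (rule assms)
  obtain K where K: "0 \<le> K" "\<And>x. norm (f x) \<le> norm x * K" using nonneg_bounded by blast
  show ?thesis
  proof (rule bounded_linear_intro)
    fix U :: "'a^'n"
    have "norm (componentwise f U) \<le> L2_set (\<lambda>i. K * norm (U $ i)) UNIV"
      unfolding norm_vec_def componentwise_def
      by (rule L2_set_mono) (use K in \<open>simp_all add: mult.commute[of K]\<close>)
    also have "\<dots> = norm U * K" using K by (simp add: norm_vec_def L2_set_right_distrib mult.commute)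
    finally show "norm (componentwise f U) \<le> norm U * K" .
  qed (simp_all add: componentwise_def vec_eq_iff add scaleR)
qed

lemma linear_H_into_dual: "linear (H_into_dual \<iota>)"
  using blinfun.bounded_linear_right bounded_linear.linear by blast

lemma linear_V_into_dual: "linear (\<lambda>u. H_into_dual \<iota> (\<iota> u))"
  using linear_compose[OF bounded_linear.linear[OF blinfun.bounded_linear_right] linear_H_into_dual, of \<iota> \<iota>]
  by (simp add: o_def)

lemma linear_duality_map: "linear duality_map"
  unfolding duality_map_def by (intro bounded_linear.linear bounded_linear_intros)

section \<open>The projected equation, data at rest and the velocity\<close>

text \<open>Paired with \<open>E\<close>, the equation in V' loses its damping term because
  \<open>D\<close> is symmetric and kills \<open>E\<close>. Testing with \<open>\<phi>\<close> gives
  the weak form of the equation for \<open>E \<cdot> U\<close>, with \<open>W\<close> as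
  acceleration.\<close>

lemma system_operator_projected:
  fixes A D :: "real^'n^'n"
  assumes "((U, Y), (Z, W)) \<in> system_operator \<iota> g A D"
    and sym: "transpose A = A" "transpose D = D" and DE: "D *v E = 0"
  shows "Y = componentwise \<iota> Z"
    and "vec_comb E U \<bullet> \<phi> + \<iota> (vec_comb (A *v E) U) \<bullet> \<iota> \<phi> + vec_comb E W \<bullet> \<iota> \<phi> = 0"
proof -
  obtain F where F: "Y = componentwise \<iota> Z" "W = - F"
    "componentwise duality_map U + mat_act A (componentwise (\<lambda>u. H_into_dual \<iota> (\<iota> u)) U)
      + mat_act D (componentwise g Z) = componentwise (H_into_dual \<iota>) F"
    using assms(1) by (auto simp: system_operator_def)
  then show "Y = componentwise \<iota> Z" by simp
  have "vec_comb 0 (X :: ('a \<Rightarrow>\<^sub>L real)^'n) = 0" for X by (simp add: vec_comb_def)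
  with arg_cong[OF F(3), of "vec_comb E"]
  have "duality_map (vec_comb E U) + H_into_dual \<iota> (\<iota> (vec_comb (A *v E) U)) = H_into_dual \<iota> (vec_comb E F)"
    by (simp add: vec_comb_add vec_comb_mat_act sym DE linear_V_into_dual linear_H_into_dual linear_duality_map vec_comb_componentwise)
  from arg_cong[OF this, of "\<lambda>l. l \<phi>"]
  show "vec_comb E U \<bullet> \<phi> + \<iota> (vec_comb (A *v E) U) \<bullet> \<iota> \<phi> + vec_comb E W \<bullet> \<iota> \<phi> = 0"
    by (simp add: blinfun.bilinear_simps duality_map_def H_into_dual_apply F(2) vec_comb_minus)
qed

text \<open>At rest (\<open>Z = 0\<close>) the damping vanishes, and the hypothesis says that Lv
  lies in H. This puts the data in the domain and gives the initial acceleration explicitly.\<close>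

lemma tensor_in_system_operator:
  fixes \<iota> :: "'v::real_inner \<Rightarrow>\<^sub>L 'h::real_inner" and A D :: "real^'n^'n"
  assumes "duality_map v = H_into_dual \<iota> h"
  shows "((tensor e v, 0), (0, - (tensor e h + tensor (A *v e) (\<iota> v)))) \<in> system_operator \<iota> g A D"
proof -
  have add: "componentwise (H_into_dual \<iota>) (x + y) = componentwise (H_into_dual \<iota>) x + componentwise (H_into_dual \<iota>) y" for x y
    by (simp add: componentwise_def vec_eq_iff blinfun.bilinear_simps)
  have zero: "componentwise f 0 = 0" if "linear f" for f :: "'c::real_vector \<Rightarrow> 'd::real_vector"
    using that by (simp add: componentwise_def vec_eq_iff linear_0)
  have g: "linear g" and i: "linear \<iota>"
    by (simp_all add: bounded_linear.linear blinfun.bounded_linear_right)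
  show ?thesis
    unfolding system_operator_def
    by (intro CollectI exI[of _ "tensor e v"] exI[of _ "0 :: 'v^'n"] exI[of _ "tensor e h + tensor (A *v e) (\<iota> v)"])
      (simp add: zero g i mat_act_0 add componentwise_tensor linear_duality_map linear_H_into_dual linear_V_into_dual mat_act_tensor assms)
qed

text \<open>Synchronization is stated with the derivative of \<open>U\<close> in H, whereas the
  semigroup provides the second component of the state. For data in the domain the two agree, as the
  orbit is differentiable and stays in the domain.\<close>

lemma velocity_eq:
  fixes \<iota> :: "'v::{real_inner,banach} \<Rightarrow>\<^sub>L 'h::{real_inner,banach}" and A D :: "real^'n^'n"
  assumes S: "C0_semigroup S" and gen: "generator S = system_operator \<iota> g A D"
    and x: "((U0, U1), y) \<in> generator S" and t: "0 \<le> t"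
  shows "velocity \<iota> (solution S U0 U1) t = snd (S t (U0, U1))"
proof -
  obtain Z W where y: "S t y = (Z, W)" by fastforce
  have Y: "snd (S t (U0, U1)) = componentwise \<iota> Z"
    using generator_orbit(1)[OF S x t] unfolding gen y by (auto simp: system_operator_def)
  have "bounded_linear (\<lambda>x :: ('v^'n) \<times> ('h^'n). componentwise \<iota> (fst x))"
    by (intro bounded_linear_compose[OF bounded_linear_componentwise] blinfun.bounded_linear_right bounded_linear_fst)
  from bounded_linear.has_vector_derivative[OF this generator_orbit(2)[OF S x t]]
  have "((\<lambda>s. componentwise \<iota> (solution S U0 U1 s)) has_vector_derivative componentwise \<iota> Z) (at t within {0..})"
    by (simp add: solution_def y)
  \<comment> \<open>Uniqueness of the derivative requires a proper filter, also at the end point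
    0.\<close>
  moreover have "at_right t \<le> at t within {0..}" using t by (intro at_le) auto
  then have "at t within {0..} \<noteq> bot" using trivial_limit_at_right_real[of t] by (metis le_bot)
  ultimately show ?thesis unfolding velocity_def Y by (intro vector_derivative_within)
qed

section \<open>The row space of C and the inverse of the duality map\<close>

lemma inner_transpose_mult: "(transpose M *v a) \<bullet> x = a \<bullet> (M *v (x :: real^'n))"
  by (simp add: transpose_matrix_vector dot_lmul_matrix)

text \<open>The row space is the orthogonal complement of the kernel of \<open>C\<close>, and a
  symmetric matrix that preserves a subspace preserves its complement. The witness comes from a left
  inverse \<open>L\<close> of \<open>transpose C\<close>, whose transpose is a right inverse of
  \<open>C\<close>.\<close>

lemma row_space_invariant:
  fixes A :: "real^'n^'n" and C :: "real^'n^'m"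
  assumes sym: "transpose A = A" and onto: "\<And>y. transpose C *v y = 0 \<Longrightarrow> y = 0"
    and inv: "\<And>e. C *v e = 0 \<Longrightarrow> C *v (A *v e) = 0"
  obtains b where "A *v (transpose C *v a) = transpose C *v b"
proof -
  obtain L where "L ** transpose C = mat 1"
    using onto matrix_left_invertible_ker[of "transpose C"] by blast
  then have right: "C ** transpose L = mat 1"
    by (metis matrix_transpose_mul transpose_mat transpose_transpose)
  have "(A *v (transpose C *v a)) \<bullet> x = (transpose C *v (L *v (A *v (transpose C *v a)))) \<bullet> x" for x
  proof -
    let ?z = "x - transpose L *v (C *v x)"
    have "C *v ?z = 0"
      by (simp add: matrix_vector_mult_diff_distrib matrix_vector_mul_assoc matrix_mul_assoc right)
    then have "a \<bullet> (C *v (A *v ?z)) = 0" by (simp add: inv)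
    then have "(A *v (transpose C *v a)) \<bullet> ?z = 0"
      by (metis inner_transpose_mult sym)
    moreover have "(transpose C *v (L *v y)) \<bullet> x = y \<bullet> (transpose L *v (C *v x))" for y
      by (metis inner_transpose_mult transpose_transpose)
    ultimately show ?thesis by (simp add: inner_diff_right)
  qed
  then show ?thesis using that vector_eq_rdot by blast
qed

text \<open>\<open>R\<close> is the restriction of L^(-1) to H. Riesz representation gives its
  existence, and density of V in H its injectivity.\<close>

lemma solution_operator_exists:
  fixes \<iota> :: "'v::{real_inner,banach} \<Rightarrow>\<^sub>L 'h::{real_inner,banach}"
  assumes dense: "closure (range \<iota>) = UNIV"
  obtains R where "linear R" "\<And>h. duality_map (R h) = H_into_dual \<iota> h" "\<And>h. R h = 0 \<Longrightarrow> h = 0"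
proof -
  have "\<exists>v. duality_map v = H_into_dual \<iota> h" for h
  proof -
    obtain v where "\<And>w. v \<bullet> w = H_into_dual \<iota> h w" by (rule riesz_representation) blast
    then show ?thesis by (intro exI[of _ v] blinfun_eqI) (simp add: duality_map_def)
  qed
  then obtain R where R: "\<And>h. duality_map (R h) = H_into_dual \<iota> h" by metis
  have inner_R: "R h \<bullet> w = h \<bullet> \<iota> w" for h w
    using arg_cong[OF R[of h], of "\<lambda>l. l w"] by (simp add: duality_map_def H_into_dual_apply)
  have "linear R"
  proof (rule linearI)
    show "R (a + b) = R a + R b" for a b
      by (rule vector_eq_rdot[THEN iffD1]) (simp add: inner_R inner_simps)
    show "R (r *\<^sub>R a) = r *\<^sub>R R a" for r a
      by (rule vector_eq_rdot[THEN iffD1]) (simp add: inner_R)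
  qed
  moreover have "h = 0" if "R h = 0" for h
  proof -
    have "range \<iota> \<subseteq> {z. h \<bullet> z = 0}" using inner_R[of h] that by auto
    moreover have "closed {z. h \<bullet> z = 0}" by (intro closed_Collect_eq continuous_intros)
    ultimately have "h \<in> {z. h \<bullet> z = 0}" using closure_minimal dense by blast
    then show ?thesis by simp
  qed
  ultimately show ?thesis using that R by blast
qed

section \<open>Evolution of pairings along orbits in the domain\<close>

lemma orbit_in_system_operator:
  assumes S: "C0_semigroup S" and gen: "generator S = system_operator \<iota> g A D"
    and x: "(x, y) \<in> generator S" and t: "0 \<le> t"
  shows "((fst (S t x), snd (S t x)), (fst (S t y), snd (S t y))) \<in> system_operator \<iota> g A D"
  using generator_orbit(1)[OF S x t] by (simp add: gen)

lemma has_vector_derivative_vec_comb_orbit: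
  assumes S: "C0_semigroup S" and x: "(x, y) \<in> generator S" and t: "0 \<le> t"
  shows "((\<lambda>t. vec_comb a (fst (S t x))) has_vector_derivative vec_comb a (fst (S t y))) (at t within {0..})"
    and "((\<lambda>t. vec_comb a (snd (S t x))) has_vector_derivative vec_comb a (snd (S t y))) (at t within {0..})"
proof -
  note orbit = generator_orbit(2)[OF S x t]
  show "((\<lambda>t. vec_comb a (fst (S t x))) has_vector_derivative vec_comb a (fst (S t y))) (at t within {0..})"
    by (rule bounded_linear.has_vector_derivative[OF bounded_linear_compose[OF bounded_linear_vec_comb bounded_linear_fst] orbit])
  show "((\<lambda>t. vec_comb a (snd (S t x))) has_vector_derivative vec_comb a (snd (S t y))) (at t within {0..})"
    by (rule bounded_linear.has_vector_derivative[OF bounded_linear_compose[OF bounded_linear_vec_comb bounded_linear_snd] orbit])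
qed

text \<open>Data with values in \<open>Ker C\<close> stay there; the initial acceleration of the solution starting
  at rest from \<open>e \<otimes> v\<close> then yields \<open>CAe = 0\<close>.\<close>

lemma kernel_invariant:
  fixes \<iota> :: "'v::{real_inner,banach} \<Rightarrow>\<^sub>L 'h::{real_inner,banach}"
    and A D :: "real^'n^'n" and C :: "real^'n^'m"
  assumes S: "C0_semigroup S" and gen: "generator S = system_operator \<iota> g A D"
    and dom: "duality_map v = H_into_dual \<iota> h" and v: "\<iota> v \<noteq> 0"
    and sync: "\<And>t. 0 \<le> t \<Longrightarrow> mat_act C (snd (S t (tensor e v, 0))) = 0"
    and ker: "C *v e = 0"
  shows "C *v (A *v e) = 0"
proof -
  let ?x = "(tensor e v, 0 :: 'h^'n)"
  let ?y = "(0 :: 'v^'n, - (tensor e h + tensor (A *v e) (\<iota> v)))"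
  have x: "(?x, ?y) \<in> generator S" unfolding gen by (rule tensor_in_system_operator[OF dom])
  have S0: "S 0 z = z" for z using S by (simp add: C0_semigroup_def)
  have "a \<bullet> (C *v (A *v e)) = 0" for a
  proof -
    let ?c = "transpose C *v a"
    have "((\<lambda>t. vec_comb ?c (snd (S t ?x))) has_vector_derivative vec_comb ?c (snd ?y)) (at 0 within {0..})"
      using has_vector_derivative_vec_comb_orbit(2)[OF S x order_refl, of ?c] by (simp only: S0)
    moreover have "vec_comb ?c (snd (S t ?x)) = 0" if "0 \<le> t" for t
      by (simp only: vec_comb_mat_act[symmetric] sync[OF that]) (simp add: vec_comb_def)
    then have "((\<lambda>t. vec_comb ?c (snd (S t ?x))) has_vector_derivative 0) (at 0 within {0..})"
      by (intro has_vector_derivative_transform[OF _ _ has_vector_derivative_const]) auto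
    moreover have "at (0 :: real) within {0..} \<noteq> bot" by (simp add: at_within_Ici_at_right)
    ultimately have "vec_comb ?c (snd ?y) = 0" by (blast intro: vector_derivative_unique_within)
    \<comment> \<open>The first term vanishes because \<open>C *v e = 0\<close>; the second then
      isolates \<open>a \<bullet> (C *v (A *v e))\<close>.\<close>
    then have "(?c \<bullet> e) *\<^sub>R h + (?c \<bullet> (A *v e)) *\<^sub>R \<iota> v = 0"
      by (simp only: snd_conv vec_comb_add vec_comb_minus vec_comb_tensor neg_equal_0_iff_equal)
    then show ?thesis using v by (simp add: dot_lmul_matrix ker)
  qed
  then show ?thesis by (metis inner_eq_zero_iff)
qed

text \<open>As \<open>DE = 0\<close>, the damping is invisible to the component \<open>u = E \<cdot> U\<close>, whose energy changes only
  through the lower order term \<open>AE \<cdot> U\<close>.\<close>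

lemma energy_increment:
  fixes \<iota> :: "'v::{real_inner,banach} \<Rightarrow>\<^sub>L 'h::{real_inner,banach}"
    and A D :: "real^'n^'n"
  assumes S: "C0_semigroup S" and gen: "generator S = system_operator \<iota> g A D"
    and sym: "transpose A = A" "transpose D = D" and DE: "D *v E = 0"
    and x: "(x, y) \<in> generator S" and "0 \<le> T"
    and b: "\<And>t. \<lbrakk>0 \<le> t; t \<le> T\<rbrakk> \<Longrightarrow>
      norm (\<iota> (vec_comb (A *v E) (fst (S t x)))) * norm (vec_comb E (snd (S t x))) \<le> b"
  shows "(norm (vec_comb E (fst (S 0 x))))\<^sup>2 + (norm (vec_comb E (snd (S 0 x))))\<^sup>2
    \<le> (norm (vec_comb E (fst (S T x))))\<^sup>2 + (norm (vec_comb E (snd (S T x))))\<^sup>2 + 2 * T * b"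
proof -
  let ?u = "\<lambda>t. vec_comb E (fst (S t x))" and ?w = "\<lambda>t. vec_comb E (snd (S t x))"
  let ?a = "\<lambda>t. \<iota> (vec_comb (A *v E) (fst (S t x)))"
  let ?e = "\<lambda>t. ?u t \<bullet> ?u t + ?w t \<bullet> ?w t"
  have deriv: "(?e has_derivative (\<lambda>h. h * (- 2 * (?a t \<bullet> ?w t)))) (at t within {0..T})"
    if t: "t \<in> {0..T}" for t
  proof -
    let ?z = "vec_comb E (fst (S t y))" and ?w' = "vec_comb E (snd (S t y))"
    have t0: "0 \<le> t" using t by simp
    note op = system_operator_projected[OF orbit_in_system_operator[OF S gen x t0] sym DE]
    have "?w t = \<iota> ?z" unfolding op(1)
      by (simp add: vec_comb_componentwise bounded_linear.linear blinfun.bounded_linear_right)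
    \<comment> \<open>The test function is the velocity itself, which lies in V because the orbit
      stays in the domain.\<close>
    with op(2)[of ?z] have eq: "?u t \<bullet> ?z + ?w' \<bullet> ?w t = - (?a t \<bullet> ?w t)" by simp
    have "(?e has_vector_derivative (?u t \<bullet> ?z + ?z \<bullet> ?u t) + (?w t \<bullet> ?w' + ?w' \<bullet> ?w t)) (at t within {0..})"
      by (intro has_vector_derivative_add bounded_bilinear.has_vector_derivative[OF bounded_bilinear_inner]
          has_vector_derivative_vec_comb_orbit[OF S x t0])
    also have "(?u t \<bullet> ?z + ?z \<bullet> ?u t) + (?w t \<bullet> ?w' + ?w' \<bullet> ?w t) = - 2 * (?a t \<bullet> ?w t)"
      using eq by (simp add: inner_commute)
    finally have "(?e has_vector_derivative - 2 * (?a t \<bullet> ?w t)) (at t within {0..T})"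
      by (rule has_vector_derivative_within_subset) auto
    then show ?thesis by (simp add: has_vector_derivative_def)
  qed
  obtain t where t: "t \<in> {0..T}" and "?e T - ?e 0 = (T - 0) * (- 2 * (?a t \<bullet> ?w t))"
    using mvt_very_simple[OF \<open>0 \<le> T\<close> deriv] by (metis atLeastAtMost_iff)
  then have "?e 0 = ?e T + 2 * T * (?a t \<bullet> ?w t)" by (simp add: algebra_simps)
  moreover have "?a t \<bullet> ?w t \<le> b" using norm_cauchy_schwarz[of "?a t" "?w t"] b[of t] t by simp
  ultimately show ?thesis using \<open>0 \<le> T\<close> by (simp add: power2_norm_eq_inner mult_left_mono)
qed

text \<open>The derivative in H of the term is the paired velocity, bounded by \<open>B\<close>.
  Smallness at finitely many times can thus be extended to an interval.\<close>

lemma lipschitz_lower_order_term: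
  fixes \<iota> :: "'v::{real_inner,banach} \<Rightarrow>\<^sub>L 'h::{real_inner,banach}"
    and A D :: "real^'n^'n"
  assumes S: "C0_semigroup S" and gen: "generator S = system_operator \<iota> g A D"
    and x: "(x, y) \<in> generator S" and "0 \<le> s" "0 \<le> t"
    and bound: "\<And>t. 0 \<le> t \<Longrightarrow> norm (vec_comb a (snd (S t x))) \<le> B"
  shows "norm (\<iota> (vec_comb a (fst (S t x))) - \<iota> (vec_comb a (fst (S s x)))) \<le> B * \<bar>t - s\<bar>"
proof -
  have "((\<lambda>t. \<iota> (vec_comb a (fst (S t x)))) has_derivative (\<lambda>h. h *\<^sub>R vec_comb a (snd (S t x)))) (at t within {0..})"
    if t: "0 \<le> t" for t
  proof -
    have "snd (S t x) = componentwise \<iota> (fst (S t y))"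
      using orbit_in_system_operator[OF S gen x t] by (auto simp: system_operator_def)
    then have "vec_comb a (snd (S t x)) = \<iota> (vec_comb a (fst (S t y)))"
      by (simp add: vec_comb_componentwise bounded_linear.linear blinfun.bounded_linear_right)
    then show ?thesis
      using bounded_linear.has_vector_derivative[OF blinfun.bounded_linear_right[of \<iota>]
          has_vector_derivative_vec_comb_orbit(1)[OF S x t, of a]]
      by (simp add: has_vector_derivative_def)
  qed
  moreover have "onorm (\<lambda>h. h *\<^sub>R vec_comb a (snd (S t x))) \<le> B" if "0 \<le> t" for t
    using bound[OF that] by (intro onorm_bound) (auto simp: mult.commute[of B] mult_left_mono intro: order_trans[OF norm_ge_zero])
  ultimately show ?thesis
    using differentiable_bound[of "{0..}" "\<lambda>t. \<iota> (vec_comb a (fst (S t x)))"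
        "\<lambda>t h. h *\<^sub>R vec_comb a (snd (S t x))" B t s] \<open>0 \<le> s\<close> \<open>0 \<le> t\<close>
    by simp
qed

section \<open>The rank bound, by contradiction with the energy estimate\<close>

theorem proposition3p5:
  fixes \<iota> :: "'v::{real_inner,banach} \<Rightarrow>\<^sub>L 'h::{real_inner,banach}"
    and g :: "'v \<Rightarrow>\<^sub>L ('v \<Rightarrow>\<^sub>L real)"
    and A D :: "real^'n::{finite,linorder}^'n::_"
    and S :: "real \<Rightarrow> (('v^'n::_) \<times> ('h^'n::_)) \<Rightarrow>\<^sub>L (('v^'n::_) \<times> ('h^'n::_))"
    and p :: nat
    and n :: "nat \<Rightarrow> nat"
    and C\<^sub>p :: "real^'n::_^'m::{finite,linorder}"
  assumes "gelfand_triple \<iota>"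
    and "\<And>u v. g u v = g v u"
    and "\<And>v. g v v \<ge> 0"
    and "transpose A = A" and "\<And>x. x \<bullet> (A *v x) \<ge> 0"
    and "transpose D = D" and "\<And>x. x \<bullet> (D *v x) \<ge> 0"
    and "p \<ge> 1"
    and "group_partition p n CARD('n)"
    and "CARD('m) = CARD('n) - p"
    and "C\<^sub>p = sync_matrix p n"
    and "C0_semigroup S"
    and "generator S = system_operator \<iota> g A D"
    and "uniformly_synchronizable \<iota> S C\<^sub>p"
  shows "rank (C\<^sub>p ** D) \<ge> CARD('n) - p"
proof (rule ccontr)
  note sym = assms(4,6) and S = assms(12) and gen = assms(13)
  have inj: "inj \<iota>" and dense: "closure (range \<iota>) = UNIV"
    and compact: "\<And>B. bounded B \<Longrightarrow> compact (closure (\<iota> ` B))"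
    and inf: "infinite_dimensional TYPE('h)"
    using assms(1) by (auto simp: gelfand_triple_def dense_compact_embedding_def)
  have \<iota>_nz: "\<iota> v \<noteq> 0" if "v \<noteq> 0" for v
    using inj that by (metis blinfun.zero_right injD)
  have S0: "S 0 z = z" for z using S by (simp add: C0_semigroup_def)
  have onto: "y = 0" if "transpose C\<^sub>p *v y = 0" for y
    using sync_matrix_transpose_kernel[OF assms(9,10)] that assms(11) by blast
  obtain R where R: "linear R" "\<And>h. duality_map (R h) = H_into_dual \<iota> h" "\<And>h. R h = 0 \<Longrightarrow> h = 0"
    using solution_operator_exists[OF dense] by blast
  obtain M \<omega> where "M \<ge> 1" "\<omega> > 0" and sync: "\<And>U0 U1 t. 0 \<le> t \<Longrightarrow>
      norm (mat_act C\<^sub>p (solution S U0 U1 t), mat_act C\<^sub>p (velocity \<iota> (solution S U0 U1) t))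
        \<le> M * exp (- \<omega> * t) * norm (mat_act C\<^sub>p U0, mat_act C\<^sub>p U1)"
    using assms(14) unfolding uniformly_synchronizable_def by blast
  \<comment> \<open>Data at rest, parametrized linearly by \<open>h\<close> in H; taking
    \<open>R h\<close> in V puts them in the domain. \<open>y\<close> is the value of the generator
    on them.\<close>
  define x where "x e h = (tensor e (R h) :: 'v^'n::{finite,linorder}, 0 :: 'h^'n::{finite,linorder})" for e h
  define y where "y e h = (0 :: 'v^'n::{finite,linorder}, - (tensor e h + tensor (A *v e) (\<iota> (R h))))" for e h
  have x: "(x e h, y e h) \<in> generator S" for e h
    unfolding gen x_def y_def by (rule tensor_in_system_operator[OF R(2)])
  have decay: "norm (mat_act C\<^sub>p (fst (S t (x e h)))) \<le> M * exp (- \<omega> * t) * (norm (C\<^sub>p *v e) * norm (R h))"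
      "norm (mat_act C\<^sub>p (snd (S t (x e h)))) \<le> M * exp (- \<omega> * t) * (norm (C\<^sub>p *v e) * norm (R h))"
    if "0 \<le> t" for t e h
  proof -
    let ?U = "mat_act C\<^sub>p (fst (S t (x e h)))" and ?Y = "mat_act C\<^sub>p (snd (S t (x e h)))"
    have "norm (?U, ?Y) \<le> M * exp (- \<omega> * t) * (norm (C\<^sub>p *v e) * norm (R h))"
      using sync[OF that, of "tensor e (R h)" 0] velocity_eq[OF S gen x[of e h, unfolded x_def] that]
      by (simp add: x_def solution_def mat_act_tensor mat_act_0 norm_tensor)
    then show "norm ?U \<le> M * exp (- \<omega> * t) * (norm (C\<^sub>p *v e) * norm (R h))"
      "norm ?Y \<le> M * exp (- \<omega> * t) * (norm (C\<^sub>p *v e) * norm (R h))"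
      using norm_fst_le[of ?U ?Y] norm_snd_le[of ?Y ?U] by auto
  qed
  obtain h0 :: 'h where "h0 \<noteq> 0" using infinite_dimensional_common_kernel[OF inf, of "{}"] by auto
  then have "\<iota> (R h0) \<noteq> 0" using R(3) \<iota>_nz by blast
  then have inv: "C\<^sub>p *v (A *v e) = 0" if "C\<^sub>p *v e = 0" for e
    using kernel_invariant[OF S gen R(2) _ _ that] decay(2)[of _ e h0] that by (simp add: x_def)

  assume "\<not> rank (C\<^sub>p ** D) \<ge> CARD('n) - p"
  \<comment> \<open>The transpose of \<open>C\<^sub>p ** D\<close> has \<open>CARD('m)\<close>
    columns, so deficient rank gives it a nonzero kernel vector \<open>a\<close>.\<close>
  then have "rank (transpose (C\<^sub>p ** D)) \<noteq> CARD('m)" by (simp add: rank_transpose assms(10))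
  then obtain a where "a \<noteq> 0" and a: "transpose (C\<^sub>p ** D) *v a = 0"
    using matrix_nonfull_linear_equations_eq by blast
  define E where "E = transpose C\<^sub>p *v a"
  have DE: "D *v E = 0"
    using a by (simp add: E_def matrix_transpose_mul matrix_vector_mul_assoc sym del: transpose_matrix_vector)
  define q where "q = E \<bullet> E"
  have "q > 0" using onto \<open>a \<noteq> 0\<close> by (auto simp: q_def E_def)
  \<comment> \<open>This turns the lower order term \<open>AE \<cdot> U\<close> into
    \<open>b \<cdot> C\<^sub>pU\<close>, which synchronization controls.\<close>
  obtain b where b: "A *v E = transpose C\<^sub>p *v b"
    unfolding E_def using row_space_invariant[OF sym(1) onto inv] by blast

  \<comment> \<open>\<open>K\<close> and \<open>L\<close> bound the pairings with \<open>E\<close>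
    and \<open>A *v E\<close>, obtained from \<open>C\<^sub>pU\<close> and
    \<open>C\<^sub>pU'\<close> through the coefficients \<open>a\<close> and
    \<open>b\<close>.\<close>
  define K where "K = norm a * (M * norm (C\<^sub>p *v E))"
  define L where "L = norm b * (M * norm (C\<^sub>p *v E))"
  have "K \<ge> 0" "L \<ge> 0" using \<open>M \<ge> 1\<close> by (auto simp: K_def L_def)
  have exp_le: "exp (- \<omega> * t) \<le> 1" if "0 \<le> t" for t using that \<open>\<omega> > 0\<close> by simp
  have u: "norm (vec_comb E (fst (S t (x E h)))) \<le> K * exp (- \<omega> * t) * norm (R h)"
    and w: "norm (vec_comb E (snd (S t (x E h)))) \<le> K * exp (- \<omega> * t) * norm (R h)"
    and w': "norm (vec_comb (A *v E) (snd (S t (x E h)))) \<le> L * norm (R h)"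
    if "0 \<le> t" for t h
  proof -
    show "norm (vec_comb E (fst (S t (x E h)))) \<le> K * exp (- \<omega> * t) * norm (R h)"
      using order_trans[OF norm_vec_comb mult_left_mono[OF decay(1)[OF that, of E h] norm_ge_zero[of a]]]
      by (simp add: E_def K_def ac_simps del: transpose_matrix_vector flip: vec_comb_mat_act)
    show "norm (vec_comb E (snd (S t (x E h)))) \<le> K * exp (- \<omega> * t) * norm (R h)"
      using order_trans[OF norm_vec_comb mult_left_mono[OF decay(2)[OF that, of E h] norm_ge_zero[of a]]]
      by (simp add: E_def K_def ac_simps del: transpose_matrix_vector flip: vec_comb_mat_act)
    have "norm (vec_comb (A *v E) (snd (S t (x E h)))) \<le> L * norm (R h) * exp (- \<omega> * t)"
      using order_trans[OF norm_vec_comb mult_left_mono[OF decay(2)[OF that, of E h] norm_ge_zero[of b]]]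
      by (simp add: b L_def ac_simps del: transpose_matrix_vector flip: vec_comb_mat_act)
    also have "\<dots> \<le> L * norm (R h) * 1"
      using exp_le[OF that] \<open>L \<ge> 0\<close> by (intro mult_left_mono) auto
    finally show "norm (vec_comb (A *v E) (snd (S t (x E h)))) \<le> L * norm (R h)" by simp
  qed

  text \<open>The constants are such that the decay estimate makes the energy at time \<open>T\<close> less than half the
    initial one, while a lower order term of size \<open>2\<eta>\<close> can dissipate less than the other half.\<close>
  define T where "T = 2 * K\<^sup>2 / (\<omega> * q\<^sup>2)"
  have "T \<ge> 0" using \<open>\<omega> > 0\<close> by (simp add: T_def)
  have T: "4 * K\<^sup>2 * (exp (- \<omega> * T))\<^sup>2 < q\<^sup>2"
  proof -
    \<comment> \<open>\<open>T\<close> is chosen so that exp x > x, applied to x =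
      \<open>2 * \<omega> * T\<close>, is enough.\<close>
    have "4 * K\<^sup>2 / q\<^sup>2 = 2 * \<omega> * T" using \<open>\<omega> > 0\<close> by (simp add: T_def)
    also have "\<dots> < exp (2 * \<omega> * T)" using exp_ge_add_one_self[of "2 * \<omega> * T"] by linarith
    finally have "4 * K\<^sup>2 < q\<^sup>2 * exp (2 * \<omega> * T)" using \<open>q > 0\<close> by (simp add: field_simps)
    then have "4 * K\<^sup>2 * (exp (- \<omega> * T))\<^sup>2 < q\<^sup>2 * exp (2 * \<omega> * T) * (exp (- \<omega> * T))\<^sup>2"
      by (rule mult_strict_right_mono) simp
    also have "\<dots> = q\<^sup>2"
      by (simp add: mult.assoc power2_eq_square flip: exp_add)
    finally show ?thesis .
  qed
  \<comment> \<open>The summand 1 keeps the denominator of \<open>\<eta>\<close> positive and makes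
    the bound on \<open>8 * (T * K * \<eta>)\<close> strict.\<close>
  define d where "d = T * K + 1"
  define \<eta> where "\<eta> = q\<^sup>2 / (8 * d)"
  have "T * K \<ge> 0" using \<open>T \<ge> 0\<close> \<open>K \<ge> 0\<close> by simp
  then have "d > 0" by (simp add: d_def)
  then have "\<eta> > 0" using \<open>q > 0\<close> by (simp add: \<eta>_def)
  have \<eta>: "8 * (T * K * \<eta>) < q\<^sup>2"
  proof -
    have "8 * (d * \<eta>) = q\<^sup>2" using \<open>d > 0\<close> by (simp add: \<eta>_def)
    with \<open>\<eta> > 0\<close> show ?thesis by (simp add: d_def algebra_simps)
  qed

  \<comment> \<open>A mesh for which the Lipschitz constant \<open>L * v\<close> adds at most
    \<open>\<eta> * v\<close> between a time and a nearby grid point; adding 1 to \<open>L\<close>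
    covers \<open>L = 0\<close>.\<close>
  define \<delta> where "\<delta> = \<eta> / (L + 1)"
  have "\<delta> > 0" and \<delta>: "L * \<delta> \<le> \<eta>" using \<open>\<eta> > 0\<close> \<open>L \<ge> 0\<close> by (auto simp: \<delta>_def field_simps)
  obtain G where "finite G" "G \<subseteq> {0..T}" and G: "{0..T} \<subseteq> (\<Union>s\<in>G. ball s \<delta>)"
    by (rule compactE_image[of "{0..T}" "{0..T}" "\<lambda>s. ball s \<delta>"]) (use \<open>\<delta> > 0\<close> in auto)

  text \<open>Finitely many linear conditions on \<open>h\<close> make the compact maps \<open>v \<mapsto> \<iota> (P s v)\<close> small at the grid
    points; the Lipschitz bound extends this to \<open>[0, T]\<close>.\<close>
  define P where "P s v = vec_comb (A *v E) (fst (S s (tensor E v, 0)))" for s v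
  have P: "bounded_linear (P s)" for s
    unfolding P_def
    by (intro bounded_linear_compose[OF bounded_linear_vec_comb] bounded_linear_compose[OF bounded_linear_fst]
        bounded_linear_compose[OF blinfun.bounded_linear_right] bounded_linear_Pair bounded_linear_tensor bounded_linear_zero)
  have "\<exists>Y. finite Y \<and> (\<forall>v. (\<forall>y\<in>Y. \<iota> (P s v) \<bullet> y = 0) \<longrightarrow> norm (\<iota> (P s v)) \<le> \<eta> * norm v)" for s
    by (rule compact_map_small_on_kernel[OF compact P[of s] \<open>\<eta> > 0\<close>]) (simp, blast)
  then obtain Y where "\<And>s. finite (Y s)"
    and Y: "\<And>s v. (\<And>y. y \<in> Y s \<Longrightarrow> \<iota> (P s v) \<bullet> y = 0) \<Longrightarrow> norm (\<iota> (P s v)) \<le> \<eta> * norm v"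
    by metis
  \<comment> \<open>Composition with \<open>R\<close> makes the orthogonality conditions on
    \<open>R h\<close> into linear functionals of \<open>h\<close>, so that the infinite dimension
    of H provides a nonzero solution.\<close>
  define \<Phi> where "\<Phi> = (\<lambda>(s, y) h. \<iota> (P s (R h)) \<bullet> y) ` (SIGMA s:G. Y s)"
  have "finite \<Phi>" unfolding \<Phi>_def using \<open>finite G\<close> \<open>\<And>s. finite (Y s)\<close> by auto
  moreover have "linear \<phi>" if "\<phi> \<in> \<Phi>" for \<phi>
  proof -
    obtain s y where "\<phi> = (\<lambda>h. \<iota> (P s (R h)) \<bullet> y)" using \<open>\<phi> \<in> \<Phi>\<close> by (auto simp: \<Phi>_def)
    moreover have "linear (P s)" using P by (rule bounded_linear.linear)
    ultimately show ?thesis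
      by (auto intro!: linearI simp: linear_add linear_scale R(1) blinfun.bilinear_simps inner_add_left)
  qed
  ultimately obtain h where "h \<noteq> 0" and h: "\<And>\<phi>. \<phi> \<in> \<Phi> \<Longrightarrow> \<phi> h = 0"
    using infinite_dimensional_common_kernel[OF inf] by metis
  define v where "v = norm (R h)"
  have "v > 0" using \<open>h \<noteq> 0\<close> R(3) by (auto simp: v_def)
  have on_grid: "norm (\<iota> (P s (R h))) \<le> \<eta> * v" if "s \<in> G" for s
    unfolding v_def using that h by (intro Y) (force simp: \<Phi>_def)
  have lower_order: "norm (\<iota> (vec_comb (A *v E) (fst (S t (x E h))))) \<le> 2 * \<eta> * v" if t: "0 \<le> t" "t \<le> T" for t
  proof -
    obtain s where s: "s \<in> G" "\<bar>t - s\<bar> < \<delta>"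
      using G t by (force simp: dist_real_def abs_minus_commute)
    then have "0 \<le> s" using \<open>G \<subseteq> {0..T}\<close> by auto
    let ?p = "\<lambda>t. \<iota> (vec_comb (A *v E) (fst (S t (x E h))))"
    have "norm (?p t - ?p s) \<le> L * v * \<bar>t - s\<bar>"
      unfolding v_def by (rule lipschitz_lower_order_term[OF S gen x \<open>0 \<le> s\<close> t(1) w'])
    also have "\<dots> \<le> L * v * \<delta>"
      using s(2) \<open>L \<ge> 0\<close> \<open>v > 0\<close> by (intro mult_left_mono) auto
    also have "\<dots> \<le> \<eta> * v" using mult_right_mono[OF \<delta>, of v] \<open>v > 0\<close> by (simp add: ac_simps)
    finally show ?thesis
      using on_grid[OF s(1)] norm_triangle_sub[of "?p t" "?p s"] by (simp add: P_def x_def)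
  qed
  have "norm (vec_comb E (snd (S t (x E h)))) \<le> K * v" if "0 \<le> t" for t
  proof -
    have "K * exp (- \<omega> * t) * v \<le> K * 1 * v"
      using exp_le[OF that] \<open>K \<ge> 0\<close> \<open>v > 0\<close> by (intro mult_right_mono mult_left_mono) auto
    with w[OF that, of h] show ?thesis by (simp add: v_def)
  qed
  then have "norm (\<iota> (vec_comb (A *v E) (fst (S t (x E h))))) * norm (vec_comb E (snd (S t (x E h))))
      \<le> (2 * \<eta> * v) * (K * v)" if "0 \<le> t" "t \<le> T" for t
    using that lower_order[OF that] \<open>\<eta> > 0\<close> \<open>v > 0\<close> by (intro mult_mono) auto
  note energy = energy_increment[OF S gen sym DE x \<open>T \<ge> 0\<close> this]
  \<comment> \<open>Pairing \<open>E\<close> with \<open>E \<otimes> R h\<close> gives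
    \<open>q *\<^sub>R R h\<close>.\<close>
  have "norm (vec_comb E (fst (S 0 (x E h)))) = q * v"
    using \<open>q > 0\<close> by (simp add: S0 x_def vec_comb_tensor q_def v_def)
  then have "(q * v)\<^sup>2 \<le> (norm (vec_comb E (fst (S 0 (x E h)))))\<^sup>2 + (norm (vec_comb E (snd (S 0 (x E h)))))\<^sup>2"
    by simp
  also note energy
  also have "(norm (vec_comb E (fst (S T (x E h)))))\<^sup>2 + (norm (vec_comb E (snd (S T (x E h)))))\<^sup>2 + 2 * T * ((2 * \<eta> * v) * (K * v))
      \<le> (K * exp (- \<omega> * T) * v)\<^sup>2 + (K * exp (- \<omega> * T) * v)\<^sup>2 + 2 * T * ((2 * \<eta> * v) * (K * v))"
    using u[OF \<open>T \<ge> 0\<close>, of h] w[OF \<open>T \<ge> 0\<close>, of h]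
    by (intro add_mono power_mono) (auto simp: v_def)
  \<comment> \<open>Written as a mean of two quantities, each below \<open>q\<^sup>2\<close> by the
    choices of \<open>T\<close> and \<open>\<eta>\<close>.\<close>
  also have "\<dots> = (4 * K\<^sup>2 * (exp (- \<omega> * T))\<^sup>2 + 8 * (T * K * \<eta>)) / 2 * v\<^sup>2"
    by (simp add: power_mult_distrib power2_eq_square algebra_simps)
  also have "\<dots> < q\<^sup>2 * v\<^sup>2"
    using T \<eta> \<open>v > 0\<close> by (intro mult_strict_right_mono) auto
  finally show False by (simp add: power_mult_distrib)
qed

end
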